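(* Let $a,b,c$ be positive integers with $c\ge 2$ and $\gcd(b,c)=1$. Let $\tilde{k}:=\min\{k\in\mathbb{N}: s_k(a)>c-1\}$. Then $S_{\tilde{k}-1}(a,b,c)$ is a minimal set of generators for $G_{a,b}(c)$.
   Context: $\mathbb{N}$ denotes the set of non-negative integers (including $0$). For positive integers $a,b$ let $\theta_{a,b}:\mathbb{N}\to\mathbb{N}$, $x\mapsto ax+b$. A subsemigroup $G$ of $(\mathbb{N},+)$ containing $0$ is called a $\theta_{a,b}$-semigroup if $\theta_{a,b}(y)\in G$ for every $y\in G\setminus\{0\}$. $G_{a,b}(c)$ denotes the smallest (with respect to inclusion) $\theta_{a,b}$-semigroup containing $c$. For $k\in\mathbb{N}$ set $s_0(a)=0$ and $s_k(a)=\sum_{i=0}^{k-1}a^i$ for $k\ge 1$, and $t_k(a,b,c)=a^kc+b\cdot s_k(a)$. For $m\in\mathbb{N}$ let $S_m(a,b,c)=\{t_k(a,b,c):k\in\mathbb{N},\ 0\le k\le m\}$. A set $S\subseteq\mathbb{N}$ generates $G$ if $G=\langle S\rangle$, the set of all finite linear combinations of elements of $S$ with coefficients in $\mathbb{N}$; a generating set is minimal if no proper subset of it generates $G$. *)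

theory Defs
  imports Main
begin

definition theta :: "nat \<Rightarrow> nat \<Rightarrow> nat \<Rightarrow> nat" where
  "theta a b x = a * x + b"

definition theta_semigroup :: "nat \<Rightarrow> nat \<Rightarrow> nat set \<Rightarrow> bool" where
  "theta_semigroup a b G \<longleftrightarrow>
     0 \<in> G \<and> (\<forall>x\<in>G. \<forall>y\<in>G. x + y \<in> G) \<and> (\<forall>y\<in>G - {0}. theta a b y \<in> G)"

text \<open>The order on sets is inclusion, so \<open>LEAST\<close> denotes the smallest such semigroup;
  it exists by \<open>theta_hull_eq_Inter\<close> below.\<close>

definition theta_hull :: "nat \<Rightarrow> nat \<Rightarrow> nat \<Rightarrow> nat set" where
  "theta_hull a b c = (LEAST G. theta_semigroup a b G \<and> c \<in> G)"

lemma theta_hull_eq_Inter: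
  "theta_hull a b c = \<Inter>{G. theta_semigroup a b G \<and> c \<in> G}"
  unfolding theta_hull_def
  by (rule Least_equality) (auto simp: theta_semigroup_def)

lemma theta_semigroup_theta_hull: "theta_semigroup a b (theta_hull a b c)"
  and mem_theta_hull: "c \<in> theta_hull a b c"
  and theta_hull_least: "theta_semigroup a b G \<Longrightarrow> c \<in> G \<Longrightarrow> theta_hull a b c \<subseteq> G"
  unfolding theta_hull_eq_Inter by (auto simp: theta_semigroup_def)

definition s_sum :: "nat \<Rightarrow> nat \<Rightarrow> nat" where
  "s_sum k a = (\<Sum>i<k. a ^ i)"

definition t_elem :: "nat \<Rightarrow> nat \<Rightarrow> nat \<Rightarrow> nat \<Rightarrow> nat" where
  "t_elem k a b c = a ^ k * c + b * s_sum k a"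

definition S_set :: "nat \<Rightarrow> nat \<Rightarrow> nat \<Rightarrow> nat \<Rightarrow> nat set" where
  "S_set m a b c = {t_elem k a b c | k. 0 \<le> k \<and> k \<le> m}"

definition nat_span :: "nat set \<Rightarrow> nat set" where
  "nat_span S = {\<Sum>x\<in>F. n x * x | F (n :: nat \<Rightarrow> nat). finite F \<and> F \<subseteq> S}"

definition generates :: "nat set \<Rightarrow> nat set \<Rightarrow> bool" where
  "generates S G \<longleftrightarrow> G = nat_span S"

definition minimal_generating_set :: "nat set \<Rightarrow> nat set \<Rightarrow> bool" where
  "minimal_generating_set S G \<longleftrightarrow> generates S G \<and> (\<forall>T. T \<subset> S \<longrightarrow> \<not> generates T G)"

text \<open>For positive \<open>a\<close> the minimum defining \<open>k_tilde\<close> is over a nonempty set, since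
  \<open>k \<le> s_sum k a\<close>. For \<open>c \<ge> 2\<close> its value is at least \<open>2\<close>, so neither of the natural-number
  subtractions \<open>c - 1\<close> and \<open>k_tilde a c - 1\<close> truncates.\<close>

definition k_tilde :: "nat \<Rightarrow> nat \<Rightarrow> nat" where
  "k_tilde a c = (LEAST k. s_sum k a > c - 1)"

end

theory Submission
  imports Defs
begin

text \<open>
  Put \<open>d = (a - 1) c + b\<close>. Since \<open>a\<^sup>k = (a - 1) s\<^sub>k + 1\<close>, one has
  \<open>t\<^sub>k = c + d s\<^sub>k\<close> (lemma \<open>t_elem_eq\<close>), and \<open>d\<close> is coprime to \<open>c\<close>. A sum of \<open>N\<close> of these
  elements has the form \<open>c N + d M\<close>, where \<open>M\<close> is the sum of the corresponding \<open>s\<^sub>k\<close>.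

  Generation. As \<open>a t\<^sub>k + b = t\<^sub>k\<^sub>+\<^sub>1\<close>, it suffices that every \<open>t\<^sub>k\<close> lies in the span of
  the \<open>t\<^sub>j\<close> with \<open>j < k_tilde\<close> (lemma \<open>t_elem_in_span\<close>). Let \<open>k \<ge> k_tilde\<close>, so that
  \<open>s\<^sub>k \<ge> c\<close>. Division with remainder,
  \<open>s\<^sub>k = q c + r\<close>, gives \<open>t\<^sub>k = c (1 + d q) + d r\<close>, so \<open>r\<close> has to be written as a sum of
  \<open>1 + d q\<close> numbers \<open>s\<^sub>j\<close>, where \<open>s\<^sub>0 = 0\<close> may be used for padding. If \<open>a = 1\<close>, then
  \<open>r = s\<^sub>r\<close> with \<open>r < c = k_tilde\<close>. If \<open>a \<ge> 2\<close>, then \<open>d q \<ge> c > r\<close> as \<open>q \<ge> 1\<close>, so \<open>r\<close> copies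
  of \<open>s\<^sub>1 = 1\<close> will do.

  Minimality. If \<open>t\<^sub>k\<close> with \<open>k < k_tilde\<close> were in the span of other elements \<open>t\<^sub>j\<close>, then
  \<open>t\<^sub>k = c N + d M\<close> with \<open>N \<ge> 2\<close>, that is, \<open>d (s\<^sub>k - M) = c (N - 1) > 0\<close>. By coprimality
  \<open>c\<close> divides the positive number \<open>s\<^sub>k - M\<close>, whence \<open>s\<^sub>k \<ge> c\<close>, which is false for
  \<open>k < k_tilde\<close> (lemma \<open>t_elem_not_combination\<close>).
\<close>

section \<open>Spans with coefficients in the natural numbers\<close>

lemma zero_in_nat_span: "0 \<in> nat_span S"
  unfolding nat_span_def by (rule CollectI, rule exI[of _ "{}"]) simp

lemma nat_span_superset: "S \<subseteq> nat_span S"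
proof
  fix x assume "x \<in> S"
  then show "x \<in> nat_span S"
    unfolding nat_span_def
    by (intro CollectI exI[of _ "{x}"] exI[of _ "\<lambda>_. 1"]) simp
qed

lemma nat_span_add:
  assumes "x \<in> nat_span S" "y \<in> nat_span S"
  shows "x + y \<in> nat_span S"
proof -
  obtain F n where F: "finite F" "F \<subseteq> S" and x: "x = (\<Sum>z\<in>F. n z * z)"
    using assms(1) unfolding nat_span_def by blast
  obtain F' n' where F': "finite F'" "F' \<subseteq> S" and y: "y = (\<Sum>z\<in>F'. n' z * z)"
    using assms(2) unfolding nat_span_def by blast
  let ?n = "\<lambda>z. (if z \<in> F then n z else 0) + (if z \<in> F' then n' z else 0)"
  have "x = (\<Sum>z\<in>F \<union> F'. (if z \<in> F then n z else 0) * z)"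
    unfolding x by (rule sum.mono_neutral_cong_left) (use F F' in auto)
  moreover have "y = (\<Sum>z\<in>F \<union> F'. (if z \<in> F' then n' z else 0) * z)"
    unfolding y by (rule sum.mono_neutral_cong_left) (use F F' in auto)
  ultimately have "x + y = (\<Sum>z\<in>F \<union> F'. ?n z * z)"
    by (simp only: sum.distrib distrib_right)
  then show ?thesis
    unfolding nat_span_def using F F'
    by (intro CollectI exI[of _ "F \<union> F'"] exI[of _ ?n]) simp
qed

lemma mult_closed_if_add_closed:
  fixes x :: nat
  assumes "0 \<in> H" "\<And>x y. x \<in> H \<Longrightarrow> y \<in> H \<Longrightarrow> x + y \<in> H" "x \<in> H"
  shows "m * x \<in> H"
  by (induction m) (use assms in auto)

lemma nat_span_mult: "x \<in> nat_span S \<Longrightarrow> m * x \<in> nat_span S"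
  by (rule mult_closed_if_add_closed) (auto intro: zero_in_nat_span nat_span_add)

lemma nat_span_induct [consumes 1, case_names zero base add]:
  assumes x: "x \<in> nat_span S"
    and zero: "P 0"
    and base: "\<And>x. x \<in> S \<Longrightarrow> P x"
    and add: "\<And>x y. P x \<Longrightarrow> P y \<Longrightarrow> P (x + y)"
  shows "P x"
proof -
  obtain F n where F: "finite F" "F \<subseteq> S" and x: "x = (\<Sum>z\<in>F. n z * z)"
    using x unfolding nat_span_def by blast
  have mult: "P (m * z)" if "z \<in> S" for m z
    using mult_closed_if_add_closed[of "Collect P" z m] zero base[OF that] add by simp
  show ?thesis
    unfolding x using F by (induction F rule: finite_induct) (auto intro: zero mult add)
qed

section \<open>The orbit of c and the threshold index\<close>

lemma t_elem_Suc: "t_elem (Suc k) a b c = a * t_elem k a b c + b"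
proof -
  have "s_sum (Suc k) a = 1 + a * s_sum k a"
    unfolding s_sum_def by (simp only: sum.lessThan_Suc_shift sum_distrib_left) simp
  then show ?thesis
    by (simp add: t_elem_def algebra_simps)
qed

lemma t_elem_eq:
  assumes "a > 0"
  shows "t_elem k a b c = c + ((a - 1) * c + b) * s_sum k a"
proof -
  obtain e where "a = Suc e" using assms by (cases a) auto
  then have "a ^ k = (a - 1) * s_sum k a + 1"
    by (induction k) (simp_all add: s_sum_def algebra_simps)
  then show ?thesis
    by (simp add: t_elem_def algebra_simps)
qed

lemma theta_semigroup_mem_nonzero: "theta_semigroup a b G \<Longrightarrow> x \<in> G \<Longrightarrow> x \<noteq> 0 \<Longrightarrow> theta a b x \<in> G"
  by (simp add: theta_semigroup_def)

lemma t_elem_in_theta_hull: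
  assumes "b > 0" "c > 0"
  shows "t_elem k a b c \<in> theta_hull a b c"
proof (induction k)
  case 0
  show ?case using mem_theta_hull by (simp add: t_elem_def s_sum_def)
next
  case (Suc k)
  have "t_elem k a b c \<noteq> 0"
    using assms by (cases k) (simp_all add: t_elem_Suc, simp add: t_elem_def)
  with Suc show ?case
    using theta_semigroup_mem_nonzero[OF theta_semigroup_theta_hull]
    by (simp add: t_elem_Suc theta_def)
qed

lemma s_sum_less_k_tilde:
  assumes "k < k_tilde a c" "c > 0"
  shows "s_sum k a < c"
  using not_less_Least[of k "\<lambda>k. s_sum k a > c - 1"] assms by (simp add: k_tilde_def)

lemma s_sum_ge_if_k_tilde_le:
  assumes "k \<ge> k_tilde a c" "a > 0" "c > 0"
  shows "s_sum k a \<ge> c"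
proof -
  have "c \<le> s_sum c a"
    unfolding s_sum_def using sum_mono[of "{..<c}" "\<lambda>_. 1" "\<lambda>i. a ^ i"] assms by simp
  then have "s_sum (k_tilde a c) a > c - 1"
    unfolding k_tilde_def using assms
    by (intro LeastI[of "\<lambda>k. s_sum k a > c - 1" c]) simp
  moreover have "s_sum (k_tilde a c) a \<le> s_sum k a"
    unfolding s_sum_def by (rule sum_mono2) (use assms in auto)
  ultimately show ?thesis by simp
qed

lemma t_elem_in_S_set: "k < k_tilde a c \<Longrightarrow> t_elem k a b c \<in> S_set (k_tilde a c - 1) a b c"
  unfolding S_set_def by auto

section \<open>Generation\<close>

lemma t_elem_in_span:
  assumes a: "a > 0" and b: "b > 0" and c: "c \<ge> 2"
  shows "t_elem k a b c \<in> nat_span (S_set (k_tilde a c - 1) a b c)"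
    (is "_ \<in> nat_span ?S")
proof (cases "k < k_tilde a c")
  case True
  then show ?thesis using t_elem_in_S_set nat_span_superset by blast
next
  case False
  define d where "d = (a - 1) * c + b"
  define q where "q = s_sum k a div c"
  define r where "r = s_sum k a mod c"
  have s: "s_sum k a = q * c + r" by (simp add: q_def r_def)
  have r: "r < c" using c by (simp add: r_def)
  have gen: "t_elem j a b c \<in> nat_span ?S" if "s_sum j a < c" for j
    using t_elem_in_S_set[of j a c b] s_sum_ge_if_k_tilde_le[of a c j] that nat_span_superset a c
    by (meson le_less_trans less_irrefl not_le subsetD zero_less_numeral order_less_le_trans)
  have t0: "c \<in> nat_span ?S"
    using gen[of 0] c by (simp add: t_elem_def s_sum_def)
  have tk: "t_elem k a b c = c + d * (q * c + r)"
    using t_elem_eq[OF a] by (simp add: s d_def)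
  show ?thesis
  proof (cases "a = 1")
    case True
    then have sr: "s_sum r a = r" by (simp add: s_sum_def)
    \<comment> \<open>\<open>r\<close> is the single summand \<open>s\<^sub>r\<close>; the other \<open>d q\<close> summands are \<open>s\<^sub>0\<close>, with \<open>t\<^sub>0 = c\<close>.\<close>
    then have "t_elem k a b c = t_elem r a b c + (d * q) * c"
      using t_elem_eq[OF a, of r b c] by (simp add: tk d_def algebra_simps)
    then show ?thesis
      using gen[of r] sr r nat_span_add nat_span_mult t0 by simp
  next
    case False
    have "c \<le> s_sum k a"
      using s_sum_ge_if_k_tilde_le[of a c k] \<open>\<not> k < k_tilde a c\<close> a c by simp
    then have "1 \<le> q"
      using div_le_mono[of c "s_sum k a" c] c by (simp add: q_def)
    have "c \<le> (a - 1) * c" using False a by (cases a) auto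
    also have "\<dots> \<le> d" by (simp add: d_def)
    also have "\<dots> \<le> d * q" using \<open>1 \<le> q\<close> by simp
    finally have "r \<le> d * q" using r by simp
    \<comment> \<open>\<open>1 + p\<close> is the number of copies of \<open>t\<^sub>0 = c\<close> that accompany the \<open>r\<close> copies of \<open>t\<^sub>1\<close>.\<close>
    then obtain p where p: "d * q = r + p" using le_Suc_ex by blast
    have s1: "s_sum 1 a = 1" by (simp add: s_sum_def)
    have "t_elem k a b c = c + (d * q) * c + d * r"
      by (simp add: tk algebra_simps)
    also have "\<dots> = r * t_elem 1 a b c + (1 + p) * c"
      unfolding p t_elem_eq[OF a] s1 d_def[symmetric] by (simp add: algebra_simps)
    finally show ?thesis
      using gen[of 1] s1 c nat_span_add nat_span_mult t0 by simp
  qed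
qed

lemma theta_semigroup_nat_span:
  assumes "\<And>y. y \<in> S \<Longrightarrow> a * y + b \<in> nat_span S"
  shows "theta_semigroup a b (nat_span S)"
proof -
  \<comment> \<open>The induction uses \<open>a (x + y) + b = (a x + b) + a y\<close>, so membership of \<open>y\<close> in the span
    is carried along.\<close>
  have "y \<in> nat_span S \<and> (y = 0 \<or> a * y + b \<in> nat_span S)" if "y \<in> nat_span S" for y
    using that
  proof (induction rule: nat_span_induct)
    case zero
    show ?case by (simp add: zero_in_nat_span)
  next
    case (base x)
    then show ?case using assms nat_span_superset by blast
  next
    case (add x y)
    have "a * (x + y) + b \<in> nat_span S" if "x \<noteq> 0"
      using nat_span_add[of "a * x + b" S "a * y"] nat_span_mult[of y S a] add that
      by (simp add: algebra_simps)
    with add show ?case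
      using nat_span_add[of x S y] by (cases "x = 0") auto
  qed
  then show ?thesis
    by (auto simp: theta_semigroup_def theta_def zero_in_nat_span nat_span_add)
qed

section \<open>Minimality\<close>

text \<open>The alternatives \<open>x = 0\<close>, \<open>x \<in> T\<close> and \<open>N \<ge> 2\<close> correspond to sums of no, one and
  several generators.\<close>

lemma nat_span_cases:
  assumes "x \<in> nat_span T" and T: "\<And>y. y \<in> T \<Longrightarrow> \<exists>M. y = c + d * M"
  shows "x = 0 \<or> x \<in> T \<or> (\<exists>N M. N \<ge> 2 \<and> x = c * N + d * M)"
  using assms(1)
proof (induction rule: nat_span_induct)
  case (add x y)
  have form: "\<exists>N M. N \<ge> 1 \<and> z = c * N + d * M"
    if "z \<in> T \<or> (\<exists>N M. N \<ge> 2 \<and> z = c * N + d * M)" for z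
    using that
  proof
    assume "z \<in> T"
    then show ?thesis using T[of z] by (metis mult.right_neutral order_refl)
  next
    assume "\<exists>N M. N \<ge> 2 \<and> z = c * N + d * M"
    then show ?thesis using order_trans[OF one_le_numeral] by blast
  qed
  show ?case
  proof (cases "x = 0 \<or> y = 0")
    case True
    then show ?thesis using add by auto
  next
    case False
    then obtain N M N' M' where "N \<ge> 1" "x = c * N + d * M" "N' \<ge> 1" "y = c * N' + d * M'"
      using form[of x] form[of y] add by blast
    then have "N + N' \<ge> 2 \<and> x + y = c * (N + N') + d * (M + M')"
      by (simp add: algebra_simps)
    then show ?thesis by blast
  qed
qed auto

text \<open>For \<open>s = s\<^sub>k\<close> the left-hand side is \<open>t\<^sub>k\<close>, and the right-hand side is the shape of a sum
  of at least two of the elements \<open>t\<^sub>j\<close>.\<close>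

lemma t_elem_not_combination:
  fixes c d s :: nat
  assumes "coprime c d" "c > 0" "s < c" "N \<ge> 2"
  shows "c + d * s \<noteq> c * N + d * M"
proof
  assume eq: "c + d * s = c * N + d * M"
  obtain n where N: "N = Suc (Suc n)"
    using \<open>N \<ge> 2\<close> by (metis One_nat_def Suc_1 Suc_le_D Suc_le_mono)
  have eq': "d * s = c * Suc n + d * M" using eq by (simp add: N)
  then have "d * M < d * s" using \<open>c > 0\<close> by simp
  then have "M < s" by simp
  have "d * (s - M) = c * Suc n" using eq' by (simp add: diff_mult_distrib2)
  then have "c dvd d * (s - M)" by simp
  then have "c dvd s - M" using \<open>coprime c d\<close> by (simp add: coprime_dvd_mult_right_iff)
  then have "c \<le> s - M" using \<open>M < s\<close> by (simp add: dvd_imp_le)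
  then show False using \<open>s < c\<close> by simp
qed

theorem theorem3p2:
  fixes a b c :: nat
  assumes "a > 0" and "b > 0" and "c \<ge> 2" and "gcd b c = 1"
  shows "minimal_generating_set (S_set (k_tilde a c - 1) a b c) (theta_hull a b c)"
proof -
  let ?S = "S_set (k_tilde a c - 1) a b c"
  define d where "d = (a - 1) * c + b"
  have "coprime c d"
    using assms(4) unfolding d_def coprime_iff_gcd_eq_1
    by (metis add.commute gcd.commute gcd_add_mult mult.commute)
  have t: "t_elem k a b c = c + d * s_sum k a" for k
    using t_elem_eq[OF assms(1)] by (simp add: d_def)
  have S: "\<exists>k. y = t_elem k a b c \<and> s_sum k a < c" if "y \<in> ?S" for y
  proof -
    have "s_sum 0 a < c" using assms by (simp add: s_sum_def)
    then have "k_tilde a c > 0"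
      using s_sum_ge_if_k_tilde_le[of a c 0] assms by (cases "k_tilde a c") auto
    then show ?thesis
      using that s_sum_less_k_tilde[of _ a c] assms unfolding S_set_def by fastforce
  qed
  have hull: "theta_hull a b c = nat_span ?S"
  proof
    have "theta_semigroup a b (nat_span ?S)"
      using S t_elem_in_span[OF assms(1-3)] t_elem_Suc[of _ a b c]
      by (intro theta_semigroup_nat_span) metis
    moreover have "c \<in> nat_span ?S"
      using t_elem_in_span[OF assms(1-3), of 0] by (simp add: t_elem_def s_sum_def)
    ultimately show "theta_hull a b c \<subseteq> nat_span ?S" by (rule theta_hull_least)
    show "nat_span ?S \<subseteq> theta_hull a b c"
    proof
      fix x assume "x \<in> nat_span ?S"
      then show "x \<in> theta_hull a b c"
      proof (induction rule: nat_span_induct)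
        case (base x)
        then show ?case using S t_elem_in_theta_hull[of b c _ a] assms by fastforce
      qed (use theta_semigroup_theta_hull[of a b c] in \<open>auto simp: theta_semigroup_def\<close>)
    qed
  qed
  have "nat_span T \<noteq> nat_span ?S" if T: "T \<subset> ?S" for T
  proof
    assume eq: "nat_span T = nat_span ?S"
    obtain y where y: "y \<in> ?S" "y \<notin> T" using T by blast
    obtain k where k: "y = c + d * s_sum k a" "s_sum k a < c" using S[OF y(1)] t by auto
    have "y \<in> nat_span T" using eq y(1) nat_span_superset by blast
    then have "y = 0 \<or> y \<in> T \<or> (\<exists>N M. N \<ge> 2 \<and> y = c * N + d * M)"
      by (rule nat_span_cases) (use S T t in blast)
    then show False
      using t_elem_not_combination[OF \<open>coprime c d\<close> _ k(2)] k(1) y(2) assms(3) by auto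
  qed
  then show ?thesis
    unfolding minimal_generating_set_def generates_def hull by metis
qed

end
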